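(* Let $n\ge1$ and let $\mathcal{G}$ be a finitely generated abelian semigroup of affine maps on $\mathbb{C}^n$, generated by $f_1,\dots,f_p$ ($p\ge1$). Set $\mathcal{A}=\{x\in\mathbb{C}^n : J_{\mathcal{G}}(x)=\mathbb{C}^n\}$. If $\mathcal{G}$ is not hypercyclic, then there exist an integer $0\le r\le n$ and $\mathcal{G}$-invariant affine subspaces $H_1,\dots,H_r$ of $\mathbb{C}^n$ of dimension $n-1$ such that $\mathcal{A}\subset\bigcup_{k=1}^{r}H_k$ (the union being empty if $r=0$).
   Context: An affine map of $\mathbb{C}^n$ is a map $f(x)=Ax+a$ with $A\in M_n(\mathbb{C})$ (not necessarily invertible) and $a\in\mathbb{C}^n$. The semigroup operation is composition. For $v\in\mathbb{C}^n$, $\mathcal{G}(v)=\{f(v): f\in\mathcal{G}\}$. $\mathcal{G}$ is hypercyclic if there exists $v\in\mathbb{C}^n$ with $\overline{\mathcal{G}(v)}=\mathbb{C}^n$ (closure). A subset $H\subset\mathbb{C}^n$ is $\mathcal{G}$-invariant if $f(H)\subset H$ for every $f\in\mathcal{G}$. For $\mathcal{G}$ abelian and generated by $f_1,\dots,f_p$ and $x\in\mathbb{C}^n$, $J_{\mathcal{G}}(x)$ is the set of $y\in\mathbb{C}^n$ for which there exist a sequence $(x_m)_m$ in $\mathbb{C}^n$ with $x_m\to x$ and sequences of non-negative integers $(k_m^{(j)})_m$, $j=1,\dots,p$, with $k_m^{(1)}+\dots+k_m^{(p)}\to+\infty$, such that $f_1^{k_m^{(1)}}f_2^{k_m^{(2)}}\cdots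 f_p^{k_m^{(p)}}(x_m)\to y$ (powers are iterates, products are compositions, and $f^0$ is the identity). *)

theory Defs
  imports "HOL-Analysis.Analysis"
begin

text \<open>Linear algebra is over the complex numbers throughout: on the type
  \<open>complex ^ 'n\<close> the library's \<open>vec.subspace\<close> and \<open>vec.dim\<close> refer to the complex vector space
  structure, whereas \<open>subspace\<close>, \<open>affine\<close>, \<open>dim\<close> and \<open>aff_dim\<close> refer to the underlying real
  one.\<close>

definition affine_map :: "(complex ^ 'n \<Rightarrow> complex ^ 'n) \<Rightarrow> bool" where
  "affine_map f \<longleftrightarrow> (\<exists>(A :: complex ^ 'n ^ 'n) a. f = (\<lambda>x. A *v x + a))"

definition affine_subspace_of_dim :: "nat \<Rightarrow> (complex ^ 'n) set \<Rightarrow> bool" where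
  "affine_subspace_of_dim d H \<longleftrightarrow>
     (\<exists>a S. vec.subspace S \<and> vec.dim S = d \<and> H = (\<lambda>x. a + x) ` S)"

text \<open>The generated semigroup consists of the nonempty products of generators; the identity is
  not adjoined. Adjoining it would change neither the density of an orbit (the space has no
  isolated points) nor the invariant sets.\<close>

inductive_set semigroup_gen :: "('a \<Rightarrow> 'a) set \<Rightarrow> ('a \<Rightarrow> 'a) set"
  for S :: "('a \<Rightarrow> 'a) set" where
  gen: "g \<in> S \<Longrightarrow> g \<in> semigroup_gen S"
| comp: "g \<in> semigroup_gen S \<Longrightarrow> h \<in> semigroup_gen S \<Longrightarrow> g \<circ> h \<in> semigroup_gen S"

definition abelian_maps :: "('a \<Rightarrow> 'a) set \<Rightarrow> bool" where
  "abelian_maps G \<longleftrightarrow> (\<forall>g\<in>G. \<forall>h\<in>G. g \<circ> h = h \<circ> g)"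

definition orbit_of :: "('a \<Rightarrow> 'a) set \<Rightarrow> 'a \<Rightarrow> 'a set" where
  "orbit_of G v = {g v |g. g \<in> G}"

definition hypercyclic :: "('a::topological_space \<Rightarrow> 'a) set \<Rightarrow> bool" where
  "hypercyclic G \<longleftrightarrow> (\<exists>v. closure (orbit_of G v) = UNIV)"

definition invariant_under :: "('a \<Rightarrow> 'a) set \<Rightarrow> 'a set \<Rightarrow> bool" where
  "invariant_under G H \<longleftrightarrow> (\<forall>g\<in>G. g ` H \<subseteq> H)"

text \<open>The product \<open>f 1 ^^ k 1 \<circ> f 2 ^^ k 2 \<circ> \<dots> \<circ> f p ^^ k p\<close>.\<close>

definition power_prod :: "nat \<Rightarrow> (nat \<Rightarrow> 'a \<Rightarrow> 'a) \<Rightarrow> (nat \<Rightarrow> nat) \<Rightarrow> 'a \<Rightarrow> 'a" where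
  "power_prod p f k = foldr (\<circ>) (map (\<lambda>j. f j ^^ k j) [1..<Suc p]) id"

text \<open>The extended limit set is defined from the family of generators \<open>f 1, \<dots>, f p\<close>;
  \<open>k m j\<close> is the exponent of \<open>f j\<close> at stage \<open>m\<close>.\<close>

definition J_set :: "nat \<Rightarrow> (nat \<Rightarrow> 'a \<Rightarrow> 'a) \<Rightarrow> 'a::topological_space \<Rightarrow> 'a set" where
  "J_set p f x =
     {y. \<exists>(u :: nat \<Rightarrow> 'a) (k :: nat \<Rightarrow> nat \<Rightarrow> nat).
           u \<longlonglongrightarrow> x \<and>
           filterlim (\<lambda>m. \<Sum>j=1..p. k m j) at_top sequentially \<and>
           (\<lambda>m. power_prod p f (k m) (u m)) \<longlonglongrightarrow> y}"

end

theory Submission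
  imports Defs "HOL-Computational_Algebra.Fundamental_Theorem_Algebra"
begin

text \<open>Call a point \<open>x\<close> \<^emph>\<open>cyclic\<close> if \<open>x\<close> and its orbit lie in no proper affine subspace, that is, if the
  differences \<open>h x - x\<close> for \<open>h\<close> in \<open>G\<close> span the space. The theorem follows from two facts about a
  point \<open>x\<close> whose extended limit set is everything.

  If \<open>x\<close> is cyclic, then its orbit is dense. A point \<open>u\<close> near \<open>x\<close> is obtained from \<open>x\<close> by an affine
  combination of the identity and finitely many members of \<open>G\<close> that is close to the identity and
  commutes with \<open>G\<close>. Hence \<open>g m (u m) \<longlonglongrightarrow> y\<close> with \<open>u m \<longlonglongrightarrow> x\<close> implies \<open>g m x \<longlonglongrightarrow> y\<close>
  (\<open>cyclic_point_limit_along_orbit\<close>). So if \<open>G\<close> is not hypercyclic, \<open>x\<close> is not cyclic.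

  If \<open>x\<close> is not cyclic, then some nonzero affine functional vanishes at \<open>x\<close> and is a joint eigenvector
  for composition with the members of \<open>G\<close> (\<open>noncyclic_point_weight_vector\<close>). Any other eigenfunctional
  with the same weight, that is, with the same eigenvalues, must vanish at \<open>x\<close> too: otherwise the
  eigenvalues along any sequence \<open>g m (u m)\<close> as above converge, the first functional tends to \<open>0\<close>
  along it, and so it vanishes at every point of the extended limit set, which is the whole space,
  although it is not zero (\<open>equal_weight_limit\<close>). In particular the weight is not the trivial one, which belongs to the
  nonzero constants, and \<open>x\<close> lies on the zero set of whichever eigenfunctional was chosen for that
  weight.

  So one invariant hyperplane for each nontrivial weight is enough. Eigenfunctionals of different
  weights are linearly independent in the space of affine functionals, which has dimension \<open>n + 1\<close>,
  and one weight is the trivial one; thus there are at most \<open>n\<close> hyperplanes.\<close>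

section \<open>Joint eigenvectors of commuting linear maps\<close>

text \<open>The value \<open>q(T) w\<close>, for which \<open>q\<close> and not \<open>T\<close> or \<open>w\<close> is the main variable: below it is a
  linear map from polynomials to vectors.\<close>

definition poly_map :: "complex poly \<Rightarrow> (complex ^ 'm \<Rightarrow> complex ^ 'm) \<Rightarrow> complex ^ 'm \<Rightarrow> complex ^ 'm" where
  "poly_map q T w = (\<Sum>i\<le>degree q. coeff q i *s (T ^^ i) w)"

context
  fixes T :: "complex ^ 'm \<Rightarrow> complex ^ 'm"
  assumes lin: "Vector_Spaces.linear (*s) (*s) T"
begin

lemma poly_map_pCons: "poly_map (pCons a q) T w = a *s w + T (poly_map q T w)"
proof (cases "q = 0")
  case True
  then show ?thesis
    by (simp add: poly_map_def vec.linear_0[OF lin])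
next
  case False
  then show ?thesis
    by (simp add: poly_map_def sum.atMost_Suc_shift vec.linear_sum[OF lin] vec.linear_scale[OF lin]
        del: sum.atMost_Suc)
qed

lemma poly_map_0: "poly_map 0 T w = 0"
  by (simp add: poly_map_def)

lemma poly_map_add: "poly_map (q + r) T w = poly_map q T w + poly_map r T w"
  by (induction q r rule: poly_induct2)
    (simp_all add: poly_map_0 poly_map_pCons vec.linear_add[OF lin] vec.scale_left_distrib algebra_simps)

lemma poly_map_smult: "poly_map (smult c q) T w = c *s poly_map q T w"
  by (induction q)
    (simp_all add: poly_map_0 poly_map_pCons vec.linear_scale[OF lin] vec.scale_right_distrib)

lemma poly_map_in_subspace:
  assumes "vec.subspace W" "T ` W \<subseteq> W" "w \<in> W"
  shows "poly_map q T w \<in> W"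
  by (induction q)
    (use assms in \<open>auto simp: poly_map_0 poly_map_pCons
       intro!: vec.subspace_0 vec.subspace_add vec.subspace_scale\<close>)

text \<open>Otherwise the vectors \<open>T^i w\<close> would be infinitely many independent vectors of a
  finite-dimensional space.\<close>

lemma exists_annihilating_poly: "\<exists>q. q \<noteq> 0 \<and> poly_map q T w = 0"
proof (rule ccontr)
  assume "\<not> ?thesis"
  then have nz: "poly_map q T w \<noteq> 0" if "q \<noteq> 0" for q
    using that by blast
  have inj: "inj (\<lambda>q. poly_map q T w)"
  proof (rule injI)
    fix q r assume eq: "poly_map q T w = poly_map r T w"
    have "poly_map (q + smult (-1) r) T w = poly_map q T w + (-1) *s poly_map r T w"
      by (simp only: poly_map_add poly_map_smult)
    also have "\<dots> = 0"
      unfolding eq by (simp add: vec_eq_iff)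
    finally have "q + smult (-1) r = 0"
      using nz by blast
    then show "q = r"
      by simp
  qed
  have injf: "inj (\<lambda>i. poly_map (monom 1 i) T w)"
  proof (rule injI)
    fix i j assume "poly_map (monom 1 i) T w = poly_map (monom 1 j) T w"
    then have "monom (1 :: complex) i = monom 1 j"
      using inj by (simp add: inj_def)
    then show "i = j"
      by (metis degree_monom_eq one_neq_zero)
  qed
  have indep: "vec.independent ((\<lambda>i. poly_map (monom 1 i) T w) ` UNIV)"
    unfolding vec.independent_explicit_finite_subsets
  proof (intro allI impI ballI)
    fix S u v
    assume S: "S \<subseteq> range (\<lambda>i. poly_map (monom 1 i) T w)" "finite S"
      and 0: "(\<Sum>v\<in>S. u v *s v) = 0" and v: "v \<in> S"
    let ?f = "\<lambda>i. poly_map (monom 1 i) T w"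
    obtain I where I: "S = ?f ` I" "finite I"
      using S by (meson finite_subset_image)
    have sum_poly: "poly_map (\<Sum>i\<in>I. monom (c i) i) T w = (\<Sum>i\<in>I. c i *s ?f i)" for c
      using I(2)
    proof (induction I)
      case (insert i I)
      have "poly_map (monom (c i) i) T w = c i *s ?f i"
        by (simp add: poly_map_smult[symmetric] smult_monom)
      then show ?case
        using insert by (simp add: poly_map_add)
    qed (simp add: poly_map_0)
    have "poly_map (\<Sum>i\<in>I. monom (u (?f i)) i) T w = (\<Sum>v\<in>S. u v *s v)"
      unfolding sum_poly I(1) using injf by (subst sum.reindex) (auto intro: inj_on_subset)
    then have z: "(\<Sum>i\<in>I. monom (u (?f i)) i) = 0"
      using nz 0 by auto
    obtain j where j: "j \<in> I" "v = ?f j"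
      using v I by auto
    have "coeff (\<Sum>i\<in>I. monom (u (?f i)) i) j = u (?f j)"
      using I(2) j(1) by (simp add: coeff_sum)
    then show "u v = 0"
      using z j by simp
  qed
  show False
    using vec.finiteI_independent[OF indep] injf finite_imageD infinite_UNIV_nat by blast
qed

text \<open>Peel linear factors off an annihilating polynomial of a vector of \<open>W\<close>: if
  \<open>(X - \<mu>) r\<close> annihilates \<open>w\<close>, then either \<open>r\<close> already does, or \<open>r(T) w\<close> is an eigenvector, and
  it lies in \<open>W\<close> by invariance.\<close>

lemma exists_eigenvector_in_invariant_subspace:
  assumes W: "vec.subspace W" "T ` W \<subseteq> W" and w: "w \<in> W" "w \<noteq> 0"
  shows "\<exists>\<mu>. \<exists>v\<in>W. v \<noteq> 0 \<and> T v = \<mu> *s v"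
proof -
  obtain q where "q \<noteq> 0" "poly_map q T w = 0"
    using exists_annihilating_poly by blast
  then show ?thesis
  proof (induction "degree q" arbitrary: q)
    case 0
    then obtain a where "q = [:a:]" "a \<noteq> 0"
      by (metis degree_eq_zeroE pCons_0_0)
    then show ?case
      using 0 w by (simp add: poly_map_pCons poly_map_0 vec.linear_0[OF lin])
  next
    case (Suc n)
    then have "\<not> constant (poly q)"
      by (simp add: constant_degree)
    then obtain \<mu> where "poly q \<mu> = 0"
      using fundamental_theorem_of_algebra by blast
    then obtain r where r: "q = [:-\<mu>, 1:] * r"
      by (auto simp: poly_eq_0_iff_dvd)
    have r0: "r \<noteq> 0"
      using Suc.prems r by auto
    have deg: "n = degree r"
      using Suc.hyps(2) r0 unfolding r by (subst (asm) degree_mult_eq) auto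
    let ?v = "poly_map r T w"
    have "poly_map q T w = T ?v - \<mu> *s ?v"
      unfolding r
      by (simp add: poly_map_add poly_map_smult poly_map_pCons flip: smult_minus_left)
    then have "T ?v = \<mu> *s ?v"
      using Suc.prems(2) by simp
    then show ?case
      using Suc.hyps(1)[OF deg r0] poly_map_in_subspace[OF W w(1), of r] by blast
  qed
qed

end

text \<open>A nonzero invariant subspace of least dimension must coincide with the eigenspace of each
  member of \<open>F\<close>, because by commutation that eigenspace is again invariant under all of \<open>F\<close>. So
  every nonzero vector of it is a joint eigenvector.\<close>

lemma exists_joint_eigenvector:
  fixes W :: "(complex ^ 'm) set"
  assumes lin: "\<And>T. T \<in> F \<Longrightarrow> Vector_Spaces.linear (*s) (*s) T"
    and comm: "\<And>S T w. S \<in> F \<Longrightarrow> T \<in> F \<Longrightarrow> S (T w) = T (S w)"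
    and W: "vec.subspace W" "W \<noteq> {0}" and inv: "\<And>T. T \<in> F \<Longrightarrow> T ` W \<subseteq> W"
  shows "\<exists>v\<in>W. v \<noteq> 0 \<and> (\<forall>T\<in>F. \<exists>\<mu>. T v = \<mu> *s v)"
proof -
  define P where "P = (\<lambda>U. vec.subspace U \<and> U \<noteq> {0} \<and> U \<subseteq> W \<and> (\<forall>T\<in>F. T ` U \<subseteq> U))"
  have "P W"
    using W inv by (auto simp: P_def)
  then obtain U where U: "P U" and least: "\<And>V. P V \<Longrightarrow> vec.dim U \<le> vec.dim V"
    using ex_has_least_nat[of P W vec.dim] by blast
  have sU: "vec.subspace U" and "U \<noteq> {0}" and UW: "U \<subseteq> W" and invU: "\<And>T. T \<in> F \<Longrightarrow> T ` U \<subseteq> U"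
    using U by (auto simp: P_def)
  then obtain u where u: "u \<in> U" "u \<noteq> 0"
    using vec.subspace_0 by blast
  have "\<exists>\<mu>. T u = \<mu> *s u" if T: "T \<in> F" for T
  proof -
    obtain \<mu> v where v: "v \<in> U" "v \<noteq> 0" "T v = \<mu> *s v"
      using exists_eigenvector_in_invariant_subspace[OF lin[OF T] sU invU[OF T] u] by blast
    define E where "E = {x \<in> U. T x = \<mu> *s x}"
    have "vec.subspace E"
      unfolding vec.subspace_def E_def
      using sU by (auto simp: vec.linear_0[OF lin[OF T]] vec.linear_add[OF lin[OF T]]
          vec.linear_scale[OF lin[OF T]] vec.scale_right_distrib mult.commute
          vec.subspace_0 vec.subspace_add vec.subspace_scale)
    moreover have "S ` E \<subseteq> E" if "S \<in> F" for S
      using invU[OF that] comm[OF T that] by (auto simp: E_def vec.linear_scale[OF lin[OF that]])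
    ultimately have "P E"
      using v UW by (auto simp: P_def E_def)
    then have "E = U"
      using least \<open>vec.subspace E\<close> sU by (intro vec.subspace_dim_equal) (auto simp: E_def)
    then show ?thesis
      using u by (auto simp: E_def)
  qed
  then show ?thesis
    using u UW by blast
qed

text \<open>Joint eigenvectors with different systems of eigenvalues, called weights, are independent, by
  the usual elimination: subtracting \<open>\<eta> g\<close> times a linear relation from its image under \<open>T g\<close> removes the term
  of weight \<open>\<eta>\<close>. Weights are functions on the whole index type that vanish off \<open>K\<close>, so that two
  weights with the same values on \<open>K\<close> are equal and the set \<open>X\<close> has the intended cardinality.\<close>

lemma card_weights_le_dim:
  fixes \<psi> :: "('k \<Rightarrow> complex) \<Rightarrow> complex ^ 'm"
  assumes lin: "\<And>g. Vector_Spaces.linear (*s) (*s) (T g)"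
    and eig: "\<And>\<rho> g. \<rho> \<in> X \<Longrightarrow> g \<in> K \<Longrightarrow> T g (\<psi> \<rho>) = \<rho> g *s \<psi> \<rho>"
    and nz: "\<And>\<rho>. \<rho> \<in> X \<Longrightarrow> \<psi> \<rho> \<noteq> 0"
    and off: "\<And>\<rho> g. \<rho> \<in> X \<Longrightarrow> g \<notin> K \<Longrightarrow> \<rho> g = 0"
  shows "finite X \<and> card X \<le> CARD('m)"
proof -
  have rel: "\<forall>\<rho>\<in>Y. c \<rho> = 0"
    if "finite Y" "Y \<subseteq> X" "(\<Sum>\<rho>\<in>Y. c \<rho> *s \<psi> \<rho>) = 0" for Y c
    using that
  proof (induction Y arbitrary: c)
    case (insert \<eta> Y)
    have "(\<rho> g - \<eta> g) * c \<rho> = 0" if "\<rho> \<in> Y" "g \<in> K" for \<rho> g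
    proof -
      have "(\<Sum>\<rho>\<in>insert \<eta> Y. c \<rho> *s (T g (\<psi> \<rho>))) = 0"
        using insert.prems(2)
        by (metis (no_types, lifting) lin sum.cong vec.linear_0 vec.linear_scale vec.linear_sum)
      moreover have "(\<Sum>\<rho>\<in>insert \<eta> Y. c \<rho> *s (T g (\<psi> \<rho>))) = (\<Sum>\<rho>\<in>insert \<eta> Y. (c \<rho> * \<rho> g) *s \<psi> \<rho>)"
        using insert.prems(1) eig that(2) by (intro sum.cong) auto
      moreover have "(\<Sum>\<rho>\<in>insert \<eta> Y. (\<eta> g * c \<rho>) *s \<psi> \<rho>) = 0"
        using arg_cong[OF insert.prems(2), of "\<lambda>v. \<eta> g *s v"]
        by (simp add: vec.scale_sum_right insert.hyps vec.scale_right_distrib)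
      moreover have "(\<Sum>\<rho>\<in>insert \<eta> Y. ((\<rho> g - \<eta> g) * c \<rho>) *s \<psi> \<rho>)
          = (\<Sum>\<rho>\<in>insert \<eta> Y. (c \<rho> * \<rho> g) *s \<psi> \<rho>)
            - (\<Sum>\<rho>\<in>insert \<eta> Y. (\<eta> g * c \<rho>) *s \<psi> \<rho>)"
        unfolding sum_subtractf[symmetric]
        by (rule sum.cong[OF refl]) (simp add: vec_eq_iff algebra_simps)
      ultimately have "(\<Sum>\<rho>\<in>insert \<eta> Y. ((\<rho> g - \<eta> g) * c \<rho>) *s \<psi> \<rho>) = 0"
        by simp
      then have "(\<Sum>\<rho>\<in>Y. ((\<rho> g - \<eta> g) * c \<rho>) *s \<psi> \<rho>) = 0"
        using insert.hyps by simp
      then show ?thesis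
        using insert.IH[of "\<lambda>\<rho>. (\<rho> g - \<eta> g) * c \<rho>"] insert.prems that(1) by blast
    qed
    moreover have "\<exists>g\<in>K. \<rho> g \<noteq> \<eta> g" if "\<rho> \<in> Y" for \<rho>
    proof -
      have "\<rho> \<noteq> \<eta>" "\<rho> \<in> X" "\<eta> \<in> X"
        using that insert by auto
      then show ?thesis
        using off by (metis HOL.ext)
    qed
    ultimately have c0: "c \<rho> = 0" if "\<rho> \<in> Y" for \<rho>
      using that by (metis eq_iff_diff_eq_0 mult_eq_0_iff)
    then have "c \<eta> *s \<psi> \<eta> = 0"
      using insert by simp
    then show ?case
      using c0 nz insert.prems(1) by auto
  qed auto
  have inj: "inj_on \<psi> X"
  proof (rule inj_onI, rule ccontr)
    fix \<rho> \<eta> assume *: "\<rho> \<in> X" "\<eta> \<in> X" "\<psi> \<rho> = \<psi> \<eta>" "\<rho> \<noteq> \<eta>"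
    then have "(\<Sum>\<theta>\<in>{\<rho>, \<eta>}. (if \<theta> = \<rho> then 1 else -1) *s \<psi> \<theta>) = 0"
      by simp
    then show False
      using rel[of "{\<rho>, \<eta>}" "\<lambda>\<theta>. if \<theta> = \<rho> then 1 else -1"] * by auto
  qed
  have indep: "vec.independent (\<psi> ` X)"
    unfolding vec.independent_explicit_finite_subsets
  proof (intro allI impI ballI)
    fix S u v
    assume S: "S \<subseteq> \<psi> ` X" "finite S" and 0: "(\<Sum>v\<in>S. u v *s v) = 0" and v: "v \<in> S"
    obtain Y where Y: "S = \<psi> ` Y" "finite Y" "Y \<subseteq> X"
      using S by (meson finite_subset_image)
    have "(\<Sum>\<rho>\<in>Y. u (\<psi> \<rho>) *s \<psi> \<rho>) = 0"
      using 0 unfolding Y(1) by (subst (asm) sum.reindex) (auto intro: inj_on_subset[OF inj Y(3)])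
    then show "u v = 0"
      using rel[OF Y(2,3), of "\<lambda>\<rho>. u (\<psi> \<rho>)"] v Y(1) by auto
  qed
  have "finite (\<psi> ` X)"
    using vec.finiteI_independent[OF indep] .
  moreover have "card (\<psi> ` X) \<le> CARD('m)"
    using vec.independent_card_le_dim[OF subset_UNIV indep] unfolding vec_dim_card .
  ultimately show ?thesis
    using inj by (metis card_image finite_imageD)
qed

section \<open>Affine functionals and affine maps\<close>

text \<open>The affine functionals on \<open>n\<close>-space form a vector space of dimension \<open>n + 1\<close>. Encoding them
  by their coefficients, with the constant term at index \<open>None\<close>, makes the dimension theory of
  coordinate spaces available for them.\<close>

definition affine_eval :: "complex ^ 'n option \<Rightarrow> complex ^ 'n \<Rightarrow> complex" where
  "affine_eval \<psi> x = \<psi> $ None + (\<Sum>i\<in>UNIV. \<psi> $ Some i * x $ i)"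

text \<open>The coefficients of \<open>\<psi> \<circ> g\<close>, read off from its values at the origin and at the unit vectors.
  The formula is meaningful, and linear in \<open>\<psi>\<close>, for every \<open>g\<close>, but represents \<open>\<psi> \<circ> g\<close> only when
  \<open>g\<close> is affine.\<close>

definition pullback :: "(complex ^ 'n \<Rightarrow> complex ^ 'n) \<Rightarrow> complex ^ 'n option \<Rightarrow> complex ^ 'n option" where
  "pullback g \<psi> = (\<chi> j. case j of None \<Rightarrow> affine_eval \<psi> (g 0)
     | Some i \<Rightarrow> affine_eval \<psi> (g (axis i 1)) - affine_eval \<psi> (g 0))"

lemma affine_eval_0 [simp]: "affine_eval 0 x = 0"
  by (simp add: affine_eval_def)

lemma affine_eval_add: "affine_eval (\<psi> + \<phi>) x = affine_eval \<psi> x + affine_eval \<phi> x"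
  by (simp add: affine_eval_def sum.distrib algebra_simps)

lemma affine_eval_scale: "affine_eval (c *s \<psi>) x = c * affine_eval \<psi> x"
  by (simp add: affine_eval_def sum_distrib_left algebra_simps)

lemma affine_eval_at_0 [simp]: "affine_eval \<psi> 0 = \<psi> $ None"
  by (simp add: affine_eval_def)

lemma affine_eval_axis: "affine_eval \<psi> (axis i 1) = \<psi> $ None + \<psi> $ Some i"
  by (simp add: affine_eval_def axis_def if_distrib cong: if_cong)

lemma affine_eval_ext:
  assumes "\<And>x. affine_eval \<psi> x = affine_eval \<phi> x"
  shows "\<psi> = \<phi>"
proof -
  have "\<psi> $ None = \<phi> $ None"
    using assms[of 0] by simp
  moreover have "\<psi> $ Some i = \<phi> $ Some i" for i
    using assms[of "axis i 1"] calculation by (simp add: affine_eval_axis)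
  ultimately show ?thesis
    unfolding vec_eq_iff by (metis option.exhaust)
qed

lemma linear_functional_sum:
  fixes \<phi> :: "complex ^ 'n \<Rightarrow> complex"
  assumes "Vector_Spaces.linear (*s) (*) \<phi>"
  shows "\<phi> v = (\<Sum>i\<in>UNIV. \<phi> (axis i 1) * v $ i)"
proof -
  interpret L: Vector_Spaces.linear "(*s)" "(*)" \<phi>
    by (rule assms)
  have "\<phi> v = \<phi> (\<Sum>i\<in>UNIV. v $ i *s axis i 1)"
    by (simp add: basis_expansion)
  then show ?thesis
    by (simp add: L.sum L.scale mult.commute)
qed

text \<open>Affine maps preserve affine combinations; the combination of \<open>x\<close> and the points \<open>y b\<close> is
  written so that its coefficients \<open>t b\<close> are unconstrained.\<close>

lemma affine_map_affine_comb:
  fixes g :: "complex ^ 'n \<Rightarrow> complex ^ 'n"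
  assumes "affine_map g"
  shows "g (x + (\<Sum>b\<in>B. t b *s (y b - x))) = g x + (\<Sum>b\<in>B. t b *s (g (y b) - g x))"
proof -
  obtain A a where g: "g = (\<lambda>x. A *v x + a)"
    using assms by (auto simp: affine_map_def)
  show ?thesis
    by (simp add: g matrix_vector_right_distrib vec.sum matrix_vector_mult_diff_distrib vec.scale)
qed

lemma affine_eval_pullback:
  assumes "affine_map g"
  shows "affine_eval (pullback g \<psi>) x = affine_eval \<psi> (g x)"
proof -
  have lin: "affine_eval \<psi> (y + (\<Sum>i\<in>UNIV. t i *s (z i - y)))
      = affine_eval \<psi> y + (\<Sum>i\<in>UNIV. t i * (affine_eval \<psi> (z i) - affine_eval \<psi> y))"
    for y and t :: "'a \<Rightarrow> complex" and z
    by (simp add: affine_eval_def sum.distrib algebra_simps sum_subtractf sum_distrib_left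
          sum_distrib_right, subst (1 2) sum.swap, simp add: algebra_simps)
  have "g x = g (0 + (\<Sum>i\<in>UNIV. x $ i *s (axis i 1 - 0)))"
    by (simp add: basis_expansion)
  also have "\<dots> = g 0 + (\<Sum>i\<in>UNIV. x $ i *s (g (axis i 1) - g 0))"
    by (rule affine_map_affine_comb[OF assms])
  finally have "affine_eval \<psi> (g x) = affine_eval \<psi> (g 0)
      + (\<Sum>i\<in>UNIV. x $ i * (affine_eval \<psi> (g (axis i 1)) - affine_eval \<psi> (g 0)))"
    by (simp only: lin)
  then show ?thesis
    by (subst affine_eval_def) (simp add: pullback_def mult.commute)
qed

lemma linear_pullback: "Vector_Spaces.linear (*s) (*s) (pullback g)"
  by unfold_locales
    (auto simp: pullback_def vec_eq_iff affine_eval_add affine_eval_scale right_diff_distrib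
      split: option.split)

lemma tendsto_affine_eval [tendsto_intros]:
  "(u \<longlongrightarrow> x) F \<Longrightarrow> ((\<lambda>m. affine_eval \<psi> (u m)) \<longlongrightarrow> affine_eval \<psi> x) F"
  unfolding affine_eval_def by (intro tendsto_intros)

text \<open>Extend a basis of \<open>S\<close> to the whole space; the coordinate along an added basis vector
  vanishes on \<open>S\<close>.\<close>

lemma exists_functional_vanishing_on_proper_subspace:
  fixes S :: "(complex ^ 'n) set"
  assumes S: "vec.subspace S" "S \<noteq> UNIV"
  obtains \<phi> :: "complex ^ 'n \<Rightarrow> complex" and b
  where "Vector_Spaces.linear (*s) (*) \<phi>" "\<And>v. v \<in> S \<Longrightarrow> \<phi> v = 0" "\<phi> b = 1"
proof -
  obtain B where B: "B \<subseteq> S" "vec.independent B" "S \<subseteq> vec.span B"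
    using vec.maximal_independent_subset by blast
  obtain C where C: "B \<subseteq> C" "vec.independent C" "UNIV \<subseteq> vec.span C"
    using vec.maximal_independent_subset_extend[OF subset_UNIV B(2)] .
  have "vec.span B \<subseteq> S"
    using vec.span_minimal[OF B(1) S(1)] .
  then have "B \<noteq> C"
    using C(3) S(2) by auto
  then obtain b where b: "b \<in> C" "b \<notin> B"
    using C by blast
  let ?\<phi> = "\<lambda>v. vec.representation C v b"
  show thesis
  proof
    show "Vector_Spaces.linear (*s) (*) ?\<phi>"
      using vec.linear_representation C by blast
    show "?\<phi> v = 0" if "v \<in> S" for v
    proof -
      have "vec.representation C v = vec.representation B v"
        using C B that by (intro vec.representation_extend) auto
      then show ?thesis
        using b by (metis vec.representation_ne_zero)
    qed
    show "?\<phi> b = 1"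
      using vec.representation_basis[OF C(2) b(1)] by simp
  qed
qed

text \<open>The kernel of the linear part together with one vector on which it is \<open>1\<close> spans the space, so
  the kernel has codimension one.\<close>

lemma zero_set_affine_subspace:
  fixes \<psi> :: "complex ^ ('n::finite) option"
  assumes "\<psi> $ Some i \<noteq> 0"
  shows "affine_subspace_of_dim (CARD('n) - 1) {x. affine_eval \<psi> x = 0}"
proof -
  define \<phi> where "\<phi> = (\<lambda>x :: complex ^ 'n. \<Sum>i\<in>UNIV. \<psi> $ Some i * x $ i)"
  define S where "S = {x. \<phi> x = 0}"
  define b :: "complex ^ 'n" where "b = axis i (1 / \<psi> $ Some i)"
  have b: "\<phi> b = 1"
    using assms by (simp add: \<phi>_def b_def axis_def if_distrib cong: if_cong)
  have add: "\<phi> (x + y) = \<phi> x + \<phi> y" and scale: "\<phi> (c *s x) = c * \<phi> x" for x y c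
    by (simp_all add: \<phi>_def sum.distrib algebra_simps sum_distrib_left)
  have eval: "affine_eval \<psi> x = \<psi> $ None + \<phi> x" for x
    by (simp add: affine_eval_def \<phi>_def)
  have "\<phi> 0 = 0"
    by (simp add: \<phi>_def)
  then have S: "vec.subspace S"
    by (auto simp: vec.subspace_def S_def add scale)
  have "v \<in> vec.span (insert b S)" for v
  proof -
    have "\<phi> (v - \<phi> v *s b) = 0"
      using add[of "v - \<phi> v *s b" "\<phi> v *s b"] by (simp add: scale b)
    then have "v - \<phi> v *s b \<in> vec.span S"
      by (auto simp: S_def intro: vec.span_base)
    then show ?thesis
      unfolding vec.span_insert by blast
  qed
  then have "vec.dim (insert b S) = CARD('n)"
    by (metis UNIV_eq_I vec.dim_span vec_dim_card)
  moreover have "b \<notin> vec.span S"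
    using S b by (simp only: vec.span_eq_iff[THEN iffD2]) (simp add: S_def)
  ultimately have "vec.dim S = CARD('n) - 1"
    by (simp add: vec.dim_insert)
  moreover have "{x. affine_eval \<psi> x = 0} = (\<lambda>x. (- \<psi> $ None) *s b + x) ` S"
  proof (intro set_eqI iffI)
    fix x assume "x \<in> {x. affine_eval \<psi> x = 0}"
    then have "x + \<psi> $ None *s b \<in> S"
      by (simp add: S_def add scale b eval add.commute)
    then show "x \<in> (\<lambda>x. (- \<psi> $ None) *s b + x) ` S"
      by (intro image_eqI[of _ _ "x + \<psi> $ None *s b"]) (auto simp: vec_eq_iff)
  next
    fix x assume "x \<in> (\<lambda>x. (- \<psi> $ None) *s b + x) ` S"
    then obtain s where "x = (- \<psi> $ None) *s b + s" "\<phi> s = 0"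
      by (auto simp: S_def)
    then show "x \<in> {x. affine_eval \<psi> x = 0}"
      by (simp only: mem_Collect_eq eval add scale b) simp
  qed
  ultimately show ?thesis
    unfolding affine_subspace_of_dim_def using S by blast
qed

section \<open>Extended limit sets\<close>

lemma funpow_in_semigroup_gen:
  "g \<in> semigroup_gen S \<Longrightarrow> 0 < n \<Longrightarrow> g ^^ n \<in> semigroup_gen S"
proof (induction n)
  case (Suc n)
  show ?case
  proof (cases "n = 0")
    case False
    then have "g \<circ> g ^^ n \<in> semigroup_gen S"
      using Suc by (intro semigroup_gen.comp) auto
    then show ?thesis
      by (simp only: funpow.simps)
  qed (use Suc.prems in simp)
qed simp

text \<open>Factors with exponent \<open>0\<close> are identities, and the identity need not belong to the semigroup.
  The induction therefore tracks whether a nontrivial factor has occurred.\<close>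

lemma power_prod_in_semigroup_gen:
  assumes "0 < (\<Sum>j=1..p. k j)"
  shows "power_prod p f k \<in> semigroup_gen (f ` {1..p})"
proof -
  define P where "P = (\<lambda>js. foldr (\<circ>) (map (\<lambda>j. f j ^^ k j) js) id)"
  have P: "P [] = id" "P (j # js) = f j ^^ k j \<circ> P js" for j js
    by (simp_all add: P_def)
  have *: "if \<forall>j\<in>set js. k j = 0 then P js = id else P js \<in> semigroup_gen (f ` {1..p})"
    if "set js \<subseteq> {1..p}" for js
    using that
  proof (induction js)
    case (Cons j js)
    have "f j ^^ k j = id \<and> k j = 0 \<or> f j ^^ k j \<in> semigroup_gen (f ` {1..p}) \<and> k j \<noteq> 0"
      using Cons.prems funpow_in_semigroup_gen[OF semigroup_gen.gen[of "f j" "f ` {1..p}"], of "k j"]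
      by (cases "k j = 0") (simp_all add: id_def)
    then show ?case
      using Cons by (auto simp: P split: if_splits intro: semigroup_gen.comp[unfolded comp_def])
  qed (simp add: P)
  have "\<exists>j\<in>{1..p}. k j \<noteq> 0"
    using assms by (metis less_irrefl sum.neutral)
  moreover have "set [1..<Suc p] = {1..p}"
    by auto
  ultimately have "P [1..<Suc p] \<in> semigroup_gen (f ` {1..p})"
    using *[of "[1..<Suc p]"] by (metis order_refl)
  then show ?thesis
    by (simp only: power_prod_def P_def)
qed

text \<open>A total exponent that tends to infinity is eventually positive, which puts the products into
  the semigroup; the finitely many earlier terms are dropped by a shift.\<close>

lemma J_setD:
  assumes "y \<in> J_set p f x"
  shows "\<exists>u g. u \<longlonglongrightarrow> x \<and> (\<forall>m. g m \<in> semigroup_gen (f ` {1..p})) \<and> (\<lambda>m. g m (u m)) \<longlonglongrightarrow> y"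
proof -
  obtain u k where u: "u \<longlonglongrightarrow> x" and k: "filterlim (\<lambda>m. \<Sum>j=1..p. k m j) at_top sequentially"
    and y: "(\<lambda>m. power_prod p f (k m) (u m)) \<longlonglongrightarrow> y"
    using assms by (auto simp: J_set_def)
  have "\<forall>\<^sub>F m in sequentially. 1 \<le> (\<Sum>j=1..p. k m j)"
    using k by (simp add: filterlim_at_top)
  then obtain N where N: "\<And>m. m \<ge> N \<Longrightarrow> 1 \<le> (\<Sum>j=1..p. k m j)"
    by (auto simp: eventually_sequentially)
  show ?thesis
  proof (intro exI conjI allI)
    show "(\<lambda>m. u (m + N)) \<longlonglongrightarrow> x"
      using u by (rule LIMSEQ_ignore_initial_segment)
    show "power_prod p f (k (m + N)) \<in> semigroup_gen (f ` {1..p})" for m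
      using N[of "m + N"] by (intro power_prod_in_semigroup_gen) simp
    show "(\<lambda>m. power_prod p f (k (m + N)) (u (m + N))) \<longlonglongrightarrow> y"
      using y by (rule LIMSEQ_ignore_initial_segment)
  qed
qed

section \<open>Cyclic points\<close>

text \<open>The error is measured against the unknown sequence \<open>w\<close>, which is not assumed bounded. As soon
  as \<open>\<epsilon> m < 1/2\<close>, the size of \<open>w m\<close> is controlled by that of \<open>v m\<close>, and the error by \<open>v\<close> alone.\<close>

lemma tendsto_of_relatively_small_perturbation:
  fixes v w :: "nat \<Rightarrow> 'a::real_normed_vector"
  assumes v: "v \<longlonglongrightarrow> y" and \<epsilon>: "\<epsilon> \<longlonglongrightarrow> 0"
    and bound: "\<And>m. norm (v m - w m) \<le> \<epsilon> m * (1 + norm (w m))"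
  shows "w \<longlonglongrightarrow> y"
proof -
  have "\<forall>\<^sub>F m in sequentially. \<epsilon> m < 1/2"
    using order_tendstoD(2)[OF \<epsilon>, of "1/2"] by simp
  then have "\<forall>\<^sub>F m in sequentially. norm (v m - w m) \<le> \<epsilon> m * (2 * (1 + norm (v m)))"
  proof eventually_elim
    case (elim m)
    have "0 \<le> \<epsilon> m * (1 + norm (w m))"
      using bound[of m] norm_ge_zero order_trans by blast
    then have "0 \<le> \<epsilon> m"
      by (simp add: zero_le_mult_iff add_nonneg_eq_0_iff) (smt (verit) norm_ge_zero)
    have "norm (w m) \<le> norm (v m) + norm (v m - w m)"
      using norm_triangle_sub[of "w m" "v m"] by (simp add: norm_minus_commute)
    also have "norm (v m - w m) \<le> 1/2 * (1 + norm (w m))"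
      using bound[of m] elim by (smt (verit) mult_right_mono norm_ge_zero)
    finally have "1 + norm (w m) \<le> 2 * (1 + norm (v m))"
      by (simp add: field_simps)
    then show ?case
      using bound[of m] \<open>0 \<le> \<epsilon> m\<close> by (meson mult_left_mono order_trans)
  qed
  moreover have "(\<lambda>m. \<epsilon> m * (2 * (1 + norm (v m)))) \<longlonglongrightarrow> 0 * (2 * (1 + norm y))"
    by (intro tendsto_intros \<epsilon> v)
  ultimately have "(\<lambda>m. v m - w m) \<longlonglongrightarrow> 0"
    by (intro Lim_null_comparison[of "\<lambda>m. v m - w m"]) auto
  then have "(\<lambda>m. v m - (v m - w m)) \<longlonglongrightarrow> y - 0"
    by (intro tendsto_intros v)
  then show ?thesis
    by simp
qed

lemma norm_complex_scale: "norm (c *s (v :: complex ^ 'n)) = norm c * norm v"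
  by (simp add: norm_vec_def norm_mult L2_set_right_distrib)

lemma affine_map_displacement_bound:
  assumes "affine_map h"
  shows "\<exists>K. \<forall>w. norm (h w - w) \<le> K * (1 + norm w)"
proof -
  obtain A a where h: "h = (\<lambda>x. A *v x + a)"
    using assms by (auto simp: affine_map_def)
  obtain L where L: "\<And>w. norm (A *v w) \<le> norm w * L" "L > 0"
    using bounded_linear.pos_bounded[OF matrix_vector_mul_bounded_linear[of A]] by blast
  have "norm (h w - w) \<le> (L + norm a + 1) * (1 + norm w)" for w
  proof -
    have "norm (h w - w) \<le> norm (A *v w) + norm a + norm w"
      unfolding h by (smt (verit) norm_triangle_ineq norm_triangle_ineq4)
    also have "\<dots> \<le> norm w * L + norm a + norm w"
      using L by simp
    also have "\<dots> \<le> (L + norm a + 1) * (1 + norm w)"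
      using L(2) by (simp add: algebra_simps)
    finally show ?thesis .
  qed
  then show ?thesis
    by blast
qed

lemma tendsto_linear_functional:
  fixes \<phi> :: "complex ^ 'n \<Rightarrow> complex"
  assumes "Vector_Spaces.linear (*s) (*) \<phi>" "(u \<longlongrightarrow> v) F"
  shows "((\<lambda>m. \<phi> (u m)) \<longlongrightarrow> \<phi> v) F"
proof -
  have "((\<lambda>m. \<Sum>i\<in>UNIV. \<phi> (axis i 1) * u m $ i) \<longlongrightarrow> (\<Sum>i\<in>UNIV. \<phi> (axis i 1) * v $ i)) F"
    by (intro tendsto_intros assms(2))
  then show ?thesis
    by (simp only: linear_functional_sum[OF assms(1), symmetric])
qed

text \<open>This is where points close to \<open>x\<close> are replaced by \<open>x\<close> itself. By cyclicity \<open>u m\<close> is an affine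
  combination of \<open>x\<close> and finitely many points \<open>h b x\<close>, with coefficients that tend to \<open>0\<close> on the
  latter. Since \<open>g m\<close> is affine and commutes with each \<open>h b\<close>, the point \<open>g m (u m)\<close> is the same
  combination of \<open>g m x\<close> and its images under the fixed maps \<open>h b\<close>: a perturbation of \<open>g m x\<close>,
  small relative to its size.\<close>

lemma cyclic_point_limit_along_orbit:
  fixes x :: "complex ^ 'n"
  assumes aff: "\<And>g. g \<in> G \<Longrightarrow> affine_map g" and abelian: "abelian_maps G"
    and cyclic: "vec.span ((\<lambda>h. h x - x) ` G) = UNIV"
    and u: "u \<longlonglongrightarrow> x" and g: "\<And>m. g m \<in> G" and y: "(\<lambda>m. g m (u m)) \<longlonglongrightarrow> y"
  shows "(\<lambda>m. g m x) \<longlonglongrightarrow> y"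
proof -
  obtain B where B: "B \<subseteq> (\<lambda>h. h x - x) ` G" "vec.independent B" "(\<lambda>h. h x - x) ` G \<subseteq> vec.span B"
    using vec.maximal_independent_subset by blast
  have spanB: "vec.span B = UNIV"
    using B(3) cyclic by (metis UNIV_I subsetI top.extremum_uniqueI vec.span_minimal vec.subspace_span)
  have finB: "finite B"
    using vec.finiteI_independent[OF B(2)] .
  have "\<forall>b\<in>B. \<exists>h\<in>G. h x - x = b"
    using B(1) by blast
  then obtain h where h: "\<And>b. b \<in> B \<Longrightarrow> h b \<in> G" "\<And>b. b \<in> B \<Longrightarrow> h b x - x = b"
    by metis
  \<comment> \<open>Coordinates of a displacement in the basis \<open>B\<close>; they depend continuously on it.\<close>
  define c where "c = (\<lambda>b v. vec.representation B v b)"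
  have lin_c: "Vector_Spaces.linear (*s) (*) (c b)" for b
    unfolding c_def using vec.linear_representation[OF B(2) spanB] .
  have "\<exists>K. \<forall>b\<in>B. \<forall>w. norm (h b w - w) \<le> K b * (1 + norm w)"
    using affine_map_displacement_bound[OF aff[OF h(1)]] by metis
  then obtain K where K: "\<And>b w. b \<in> B \<Longrightarrow> norm (h b w - w) \<le> K b * (1 + norm w)"
    by blast
  define \<epsilon> where "\<epsilon> = (\<lambda>m. \<Sum>b\<in>B. norm (c b (u m - x)) * K b)"
  have gu: "g m (u m) = g m x + (\<Sum>b\<in>B. c b (u m - x) *s (h b (g m x) - g m x))" for m
  proof -
    have "u m = x + (\<Sum>b\<in>B. c b (u m - x) *s b)"
      unfolding c_def using vec.sum_representation_eq[of B "u m - x" B] B(2) spanB finB by simp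
    also have "\<dots> = x + (\<Sum>b\<in>B. c b (u m - x) *s (h b x - x))"
      using h(2) by simp
    finally have "g m (u m) = g m (x + (\<Sum>b\<in>B. c b (u m - x) *s (h b x - x)))"
      by simp
    also have "\<dots> = g m x + (\<Sum>b\<in>B. c b (u m - x) *s (g m (h b x) - g m x))"
      by (rule affine_map_affine_comb[OF aff[OF g]])
    also have "g m (h b x) = h b (g m x)" if "b \<in> B" for b
      using abelian g h(1)[OF that] unfolding abelian_maps_def by (metis comp_apply)
    then have "(\<Sum>b\<in>B. c b (u m - x) *s (g m (h b x) - g m x))
        = (\<Sum>b\<in>B. c b (u m - x) *s (h b (g m x) - g m x))"
      by simp
    finally show ?thesis .
  qed
  have bound: "norm (g m (u m) - g m x) \<le> \<epsilon> m * (1 + norm (g m x))" for m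
  proof -
    have "norm (g m (u m) - g m x) \<le> (\<Sum>b\<in>B. norm (c b (u m - x) *s (h b (g m x) - g m x)))"
      unfolding gu by (simp add: norm_sum)
    also have "\<dots> \<le> (\<Sum>b\<in>B. norm (c b (u m - x)) * (K b * (1 + norm (g m x))))"
      unfolding norm_complex_scale by (intro sum_mono mult_left_mono K) auto
    finally show ?thesis
      by (simp add: \<epsilon>_def sum_distrib_right mult.assoc)
  qed
  have "\<epsilon> \<longlonglongrightarrow> (\<Sum>b\<in>B. norm (c b (x - x)) * K b)"
    unfolding \<epsilon>_def by (intro tendsto_intros tendsto_linear_functional[OF lin_c] u)
  then have "\<epsilon> \<longlonglongrightarrow> 0"
    by (simp add: c_def vec.representation_zero)
  then show ?thesis
    using tendsto_of_relatively_small_perturbation[OF y _ bound] by blast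
qed

lemma cyclic_J_point_hypercyclic:
  fixes f :: "nat \<Rightarrow> complex ^ 'n \<Rightarrow> complex ^ 'n"
  assumes G: "G = semigroup_gen (f ` {1..p})"
    and aff: "\<And>g. g \<in> G \<Longrightarrow> affine_map g" and abelian: "abelian_maps G"
    and cyclic: "vec.span ((\<lambda>h. h x - x) ` G) = UNIV" and J: "J_set p f x = UNIV"
  shows "hypercyclic G"
proof -
  have "y \<in> closure (orbit_of G x)" for y
  proof -
    have "y \<in> J_set p f x"
      using J by simp
    then obtain u g where ug: "u \<longlonglongrightarrow> x" "\<And>m. g m \<in> G" "(\<lambda>m. g m (u m)) \<longlonglongrightarrow> y"
      unfolding G using J_setD by blast
    have "(\<lambda>m. g m x) \<longlonglongrightarrow> y"
      using cyclic_point_limit_along_orbit[OF aff abelian cyclic ug] .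
    moreover have "\<forall>m. g m x \<in> orbit_of G x"
      using ug(2) by (auto simp: orbit_of_def)
    ultimately show ?thesis
      unfolding closure_sequential by (intro exI[of _ "\<lambda>m. g m x"] conjI)
  qed
  then show ?thesis
    unfolding hypercyclic_def by blast
qed

section \<open>Weights of affine functionals\<close>

text \<open>Joint eigenvectors of the pullbacks along \<open>G\<close>. The weight \<open>\<rho>\<close> is
  normalised to \<open>0\<close> off \<open>G\<close> so that it is determined by its values on \<open>G\<close>, and weights can be
  counted.\<close>

definition affine_weight_vector :: "(complex ^ 'n \<Rightarrow> complex ^ 'n) set
    \<Rightarrow> ((complex ^ 'n \<Rightarrow> complex ^ 'n) \<Rightarrow> complex) \<Rightarrow> complex ^ 'n option \<Rightarrow> bool" where
  "affine_weight_vector G \<rho> \<psi> \<longleftrightarrow> \<psi> \<noteq> 0 \<and> (\<forall>g. g \<notin> G \<longrightarrow> \<rho> g = 0) \<and>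
     (\<forall>g\<in>G. \<forall>z. affine_eval \<psi> (g z) = \<rho> g * affine_eval \<psi> z)"

text \<open>Along \<open>g m (u m)\<close> both functionals are scaled by the same factor \<open>\<rho> (g m)\<close>. The first one is
  not zero at \<open>x\<close>, so convergence of its values forces the factors to converge; the values of the
  second are then convergent factors times a null sequence.\<close>

lemma equal_weight_limit:
  assumes eig0: "affine_weight_vector G \<rho> \<psi>\<^sub>0" and eig: "affine_weight_vector G \<rho> \<psi>"
    and x0: "affine_eval \<psi>\<^sub>0 x \<noteq> 0" and x: "affine_eval \<psi> x = 0"
    and u: "u \<longlonglongrightarrow> x" and g: "\<And>m. g m \<in> G" and y: "(\<lambda>m. g m (u m)) \<longlonglongrightarrow> y"
  shows "affine_eval \<psi> y = 0"
proof -
  have "(\<lambda>m. affine_eval \<psi>\<^sub>0 (g m (u m)) / affine_eval \<psi>\<^sub>0 (u m) * affine_eval \<psi> (u m))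
      \<longlonglongrightarrow> affine_eval \<psi>\<^sub>0 y / affine_eval \<psi>\<^sub>0 x * affine_eval \<psi> x"
    by (intro tendsto_intros u y x0)
  moreover have "\<forall>\<^sub>F m in sequentially. affine_eval \<psi>\<^sub>0 (u m) \<noteq> 0"
    using tendsto_affine_eval[OF u] x0 by (rule tendsto_imp_eventually_ne)
  then have "\<forall>\<^sub>F m in sequentially.
      affine_eval \<psi>\<^sub>0 (g m (u m)) / affine_eval \<psi>\<^sub>0 (u m) * affine_eval \<psi> (u m) = affine_eval \<psi> (g m (u m))"
    by eventually_elim (use eig0 eig g in \<open>simp add: affine_weight_vector_def\<close>)
  ultimately have "(\<lambda>m. affine_eval \<psi> (g m (u m))) \<longlonglongrightarrow> 0"
    using x by (simp add: tendsto_cong)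
  then show ?thesis
    using tendsto_affine_eval[OF y] LIMSEQ_unique by blast
qed

text \<open>The affine functionals that vanish at \<open>x\<close> and on its orbit form a subspace stable under the
  commuting pullbacks. It is nonzero since \<open>x\<close> and its orbit lie in a proper affine subspace, so it
  contains a joint eigenvector.\<close>

lemma noncyclic_point_weight_vector:
  fixes x :: "complex ^ 'n"
  assumes aff: "\<And>g. g \<in> G \<Longrightarrow> affine_map g" and abelian: "abelian_maps G"
    and closed: "\<And>g h. g \<in> G \<Longrightarrow> h \<in> G \<Longrightarrow> g \<circ> h \<in> G"
    and noncyclic: "vec.span ((\<lambda>h. h x - x) ` G) \<noteq> UNIV"
  shows "\<exists>\<rho> \<psi>. affine_weight_vector G \<rho> \<psi> \<and> affine_eval \<psi> x = 0"
proof -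
  define W where "W = {\<psi> :: complex ^ 'n option. affine_eval \<psi> x = 0 \<and> (\<forall>h\<in>G. affine_eval \<psi> (h x) = 0)}"
  have W: "vec.subspace W"
    by (auto simp: vec.subspace_def W_def affine_eval_add affine_eval_scale)
  obtain \<phi> b where lin: "Vector_Spaces.linear (*s) (*) \<phi>"
    and vanish: "\<And>v. v \<in> vec.span ((\<lambda>h. h x - x) ` G) \<Longrightarrow> \<phi> v = 0" and b: "\<phi> b = (1 :: complex)"
    using exists_functional_vanishing_on_proper_subspace[OF vec.subspace_span noncyclic] by blast
  interpret L: Vector_Spaces.linear "(*s)" "(*)" \<phi>
    by (rule lin)
  define \<psi> where "\<psi> = (\<chi> j. case j of None \<Rightarrow> - \<phi> x | Some i \<Rightarrow> \<phi> (axis i 1))"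
  have eval: "affine_eval \<psi> z = \<phi> (z - x)" for z
    using linear_functional_sum[OF lin, of z] by (simp add: affine_eval_def \<psi>_def L.diff)
  have "\<psi> \<in> W"
    using vanish by (auto simp: W_def eval L.zero intro: vec.span_base)
  moreover have "affine_eval \<psi> (x + b) \<noteq> 0"
    using b by (simp add: eval)
  then have "\<psi> \<noteq> 0"
    by auto
  ultimately have W0: "W \<noteq> {0}"
    by blast
  have inv: "T ` W \<subseteq> W" if T: "T \<in> pullback ` G" for T
  proof -
    obtain g where g: "g \<in> G" "T = pullback g"
      using T by blast
    have "affine_eval \<psi> ((g \<circ> h) x) = 0" if "\<psi> \<in> W" "h \<in> G" for \<psi> h
      using that(1) closed[OF g(1) that(2)] unfolding W_def by blast
    then show ?thesis
      using g by (auto simp: W_def affine_eval_pullback[OF aff[OF g(1)]])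
  qed
  have comm: "S (T w) = T (S w)" if S: "S \<in> pullback ` G" and T: "T \<in> pullback ` G" for S T and w :: "complex ^ 'n option"
  proof (rule affine_eval_ext)
    fix z
    obtain g h where gh: "g \<in> G" "S = pullback g" "h \<in> G" "T = pullback h"
      using S T by blast
    have "h (g z) = g (h z)"
      using abelian gh unfolding abelian_maps_def by (metis comp_apply)
    then show "affine_eval (S (T w)) z = affine_eval (T (S w)) z"
      using gh aff by (simp add: affine_eval_pullback)
  qed
  have lin_pull: "Vector_Spaces.linear (*s) (*s) T" if "T \<in> pullback ` G" for T
    using that linear_pullback by blast
  have joint: "\<exists>v\<in>W. v \<noteq> 0 \<and> (\<forall>T\<in>pullback ` G. \<exists>\<mu>. T v = \<mu> *s v)"
  proof (rule exists_joint_eigenvector)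
    show "S (T w) = T (S w)" if "S \<in> pullback ` G" "T \<in> pullback ` G"
      for S T and w :: "complex ^ 'n option"
      using that by (rule comm)
  qed (use lin_pull W W0 inv in auto)
  obtain \<psi> where \<psi>: "\<psi> \<in> W" "\<psi> \<noteq> 0" "\<forall>T\<in>pullback ` G. \<exists>\<mu>. T \<psi> = \<mu> *s \<psi>"
    using joint by blast
  have "\<forall>g. \<exists>\<mu>. if g \<in> G then pullback g \<psi> = \<mu> *s \<psi> else \<mu> = 0"
    using \<psi>(3) by auto
  then obtain \<rho> where \<rho>: "\<And>g. if g \<in> G then pullback g \<psi> = \<rho> g *s \<psi> else \<rho> g = 0"
    by metis
  have "affine_eval \<psi> (g z) = \<rho> g * affine_eval \<psi> z" if "g \<in> G" for g z
    using \<rho>[of g] that affine_eval_pullback[OF aff[OF that], of \<psi> z] by (simp add: affine_eval_scale)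
  then have "affine_weight_vector G \<rho> \<psi>"
    unfolding affine_weight_vector_def using \<psi>(2) \<rho> by metis
  then show ?thesis
    using \<psi>(1) by (auto simp: W_def)
qed

lemma card_affine_weights:
  fixes G :: "(complex ^ 'n \<Rightarrow> complex ^ 'n) set"
  assumes aff: "\<And>g. g \<in> G \<Longrightarrow> affine_map g"
  shows "finite {\<rho>. \<exists>\<psi>. affine_weight_vector G \<rho> \<psi>}"
    "card {\<rho>. \<exists>\<psi>. affine_weight_vector G \<rho> \<psi>} \<le> CARD('n) + 1"
proof -
  define X where "X = {\<rho>. \<exists>\<psi>. affine_weight_vector G \<rho> \<psi>}"
  define \<psi> where "\<psi> = (\<lambda>\<rho>. SOME \<psi>. affine_weight_vector G \<rho> \<psi>)"
  have \<psi>: "affine_weight_vector G \<rho> (\<psi> \<rho>)" if "\<rho> \<in> X" for \<rho>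
    using that unfolding \<psi>_def X_def by (metis (mono_tags) mem_Collect_eq someI_ex)
  have "finite X \<and> card X \<le> CARD('n option)"
  proof (rule card_weights_le_dim[of pullback X G \<psi>])
    show "pullback g (\<psi> \<rho>) = \<rho> g *s \<psi> \<rho>" if "\<rho> \<in> X" "g \<in> G" for \<rho> g
      by (rule affine_eval_ext)
        (use \<psi>[OF that(1)] that(2) in \<open>simp add: affine_weight_vector_def affine_eval_scale
          affine_eval_pullback[OF aff]\<close>)
  qed (use \<psi> in \<open>auto simp: affine_weight_vector_def linear_pullback\<close>)
  then show "finite {\<rho>. \<exists>\<psi>. affine_weight_vector G \<rho> \<psi>}"
    "card {\<rho>. \<exists>\<psi>. affine_weight_vector G \<rho> \<psi>} \<le> CARD('n) + 1"
    by (simp_all add: X_def card_UNIV_option)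
qed

section \<open>Covering by invariant hyperplanes\<close>

theorem corollary1p3:
  fixes f :: "nat \<Rightarrow> complex ^ 'n \<Rightarrow> complex ^ 'n"
    and p :: nat
    and G :: "(complex ^ 'n \<Rightarrow> complex ^ 'n) set"
  assumes "p \<ge> 1"
    and "G = semigroup_gen (f ` {1..p})"
    and "\<forall>g\<in>G. affine_map g"
    and "abelian_maps G"
    and "\<not> hypercyclic G"
  shows "\<exists>(r::nat) (H :: nat \<Rightarrow> (complex ^ 'n) set).
           r \<le> CARD('n) \<and>
           (\<forall>k\<in>{1..r}. affine_subspace_of_dim (CARD('n) - 1) (H k) \<and> invariant_under G (H k)) \<and>
           {x. J_set p f x = UNIV} \<subseteq> (\<Union>k\<in>{1..r}. H k)"
proof -
  have aff: "affine_map g" if "g \<in> G" for g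
    using assms(3) that by blast
  define X where "X = {\<rho>. \<exists>\<psi>. affine_weight_vector G \<rho> \<psi>}"
  define \<psi> where "\<psi> = (\<lambda>\<rho>. SOME \<psi>. affine_weight_vector G \<rho> \<psi>)"
  have \<psi>: "affine_weight_vector G \<rho> (\<psi> \<rho>)" if "\<rho> \<in> X" for \<rho>
    using that unfolding \<psi>_def X_def by (metis (mono_tags) mem_Collect_eq someI_ex)
  \<comment> \<open>The trivial weight, carried by the constants. It takes up one of the at most \<open>n + 1\<close> weights
    and contributes no hyperplane, because a nonzero constant vanishes nowhere.\<close>
  define \<rho>\<^sub>1 where "\<rho>\<^sub>1 = (\<lambda>g. if g \<in> G then 1 else 0 :: complex)"
  define \<psi>\<^sub>1 :: "complex ^ 'n option" where "\<psi>\<^sub>1 = axis None 1"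
  have one: "affine_eval \<psi>\<^sub>1 z = 1" for z
    by (simp add: affine_eval_def \<psi>\<^sub>1_def axis_def)
  have w1: "affine_weight_vector G \<rho>\<^sub>1 \<psi>\<^sub>1"
    using one unfolding affine_weight_vector_def \<rho>\<^sub>1_def
    by (auto simp: one) (metis affine_eval_0 one zero_neq_one)
  define r where "r = card (X - {\<rho>\<^sub>1})"
  have X: "finite X" "card X \<le> CARD('n) + 1"
    using card_affine_weights[OF aff] unfolding X_def by auto
  have "\<rho>\<^sub>1 \<in> X"
    using w1 by (auto simp: X_def)
  then have r: "r \<le> CARD('n)"
    using X(2) by (simp add: r_def card_Diff_singleton)
  obtain \<rho> where \<rho>: "bij_betw \<rho> {1..r} (X - {\<rho>\<^sub>1})"
    using X(1) ex_bij_betw_nat_finite_1[of "X - {\<rho>\<^sub>1}"] unfolding r_def by auto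
  define H where "H = (\<lambda>k. {x. affine_eval (\<psi> (\<rho> k)) x = 0})"
  have H: "affine_subspace_of_dim (CARD('n) - 1) (H k)" "invariant_under G (H k)" if k: "k \<in> {1..r}" for k
  proof -
    have \<rho>k: "\<rho> k \<in> X" "\<rho> k \<noteq> \<rho>\<^sub>1"
      using k \<rho> by (auto simp: bij_betw_def)
    have wk: "affine_weight_vector G (\<rho> k) (\<psi> (\<rho> k))"
      using \<psi> \<rho>k by blast
    then show "invariant_under G (H k)"
      by (auto simp: invariant_under_def H_def affine_weight_vector_def)
    \<comment> \<open>A nonconstant functional: a nonzero constant is fixed by every \<open>g\<close>, so has the trivial weight.\<close>
    have "\<exists>i. \<psi> (\<rho> k) $ Some i \<noteq> 0"
    proof (rule ccontr)
      assume "\<not> ?thesis"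
      then have const: "affine_eval (\<psi> (\<rho> k)) z = \<psi> (\<rho> k) $ None" for z
        by (simp add: affine_eval_def)
      moreover have "\<psi> (\<rho> k) $ None \<noteq> 0"
        using const wk affine_eval_ext[of "\<psi> (\<rho> k)" 0] by (auto simp: affine_weight_vector_def)
      ultimately have "\<rho> k = \<rho>\<^sub>1"
        using wk by (auto simp: affine_weight_vector_def \<rho>\<^sub>1_def)
      then show False
        using \<rho>k by simp
    qed
    then show "affine_subspace_of_dim (CARD('n) - 1) (H k)"
      unfolding H_def using zero_set_affine_subspace by blast
  qed
  have cover: "\<exists>k\<in>{1..r}. x \<in> H k" if J: "J_set p f x = UNIV" for x
  proof (rule ccontr)
    assume off: "\<not> ?thesis"
    have "vec.span ((\<lambda>h. h x - x) ` G) \<noteq> UNIV"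
      using cyclic_J_point_hypercyclic[OF assms(2) aff assms(4) _ J] assms(5) by blast
    then obtain \<sigma> \<phi> where \<phi>: "affine_weight_vector G \<sigma> \<phi>" "affine_eval \<phi> x = 0"
      using noncyclic_point_weight_vector[OF aff assms(4)] assms(2) semigroup_gen.comp by metis
    \<comment> \<open>Some functional of the same weight does not vanish at \<open>x\<close>: a constant for the trivial weight,
      and otherwise the one that defines the hyperplane of this weight, which \<open>x\<close> avoids.\<close>
    have "\<exists>\<psi>\<^sub>0. affine_weight_vector G \<sigma> \<psi>\<^sub>0 \<and> affine_eval \<psi>\<^sub>0 x \<noteq> 0"
    proof (cases "\<sigma> = \<rho>\<^sub>1")
      case True
      then show ?thesis
        using w1 one by (metis zero_neq_one)
    next
      case False
      then have "\<sigma> \<in> X - {\<rho>\<^sub>1}"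
        using \<phi> by (auto simp: X_def)
      then obtain k where "k \<in> {1..r}" "\<rho> k = \<sigma>"
        using \<rho> unfolding bij_betw_def by (metis imageE)
      then show ?thesis
        using off \<psi>[of \<sigma>] \<open>\<sigma> \<in> X - {\<rho>\<^sub>1}\<close> by (auto simp: H_def)
    qed
    then obtain \<psi>\<^sub>0 where \<psi>\<^sub>0: "affine_weight_vector G \<sigma> \<psi>\<^sub>0" "affine_eval \<psi>\<^sub>0 x \<noteq> 0"
      by blast
    have "affine_eval \<phi> y = 0" for y
    proof -
      have "y \<in> J_set p f x"
        using J by simp
      then show ?thesis
        using J_setD equal_weight_limit[OF \<psi>\<^sub>0(1) \<phi>(1) \<psi>\<^sub>0(2) \<phi>(2)] unfolding assms(2) by blast
    qed
    then have "\<phi> = 0"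
      by (intro affine_eval_ext) simp
    then show False
      using \<phi>(1) by (simp add: affine_weight_vector_def)
  qed
  show ?thesis
  proof (intro exI conjI ballI subsetI)
    show "r \<le> CARD('n)"
      by (rule r)
    show "x \<in> (\<Union>k\<in>{1..r}. H k)" if "x \<in> {x. J_set p f x = UNIV}" for x
      using cover that by blast
  qed (rule H, assumption)+
qed

end
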